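(* Let $\mathbb{K}\in\{\mathbb{R},\mathbb{C}\}$, let $d\geq 1$ be an integer, let $I\subset\mathbb{R}$ be an interval, and let $t_0\in I$. Suppose $A\colon I\to\mathbb{K}^{d\times d}$ and $b\colon I\to\mathbb{K}^d$ are continuous on $I$, and let $x_0\in\mathbb{K}^d$. Then the Cauchy problem $$\dot{x}(t)=A(t)\,x(t)+b(t)\quad (t\in I),\qquad x(t_0)=x_0,$$ has the unique solution on $I$ given by $$x(t)=\Phi_A(t;t_0)\Bigl(x_0+\int_{t_0}^{t}\Phi_A(t_0;\tau)\,b(\tau)\,d\tau\Bigr),$$ where $\Phi_A$ is given by the Peano--Baker series. When $[A(t),A(s)]=0$ for all $t,s\in I$, the formula simplifies to $$x(t)=\exp\Bigl(\int_{t_0}^{t}A(\tau)\,d\tau\Bigr)\biggl(x_0+\int_{t_0}^{t}\exp\Bigl(-\int_{t_0}^{\tau}A(\sigma)\,d\sigma\Bigr)\,b(\tau)\,d\tau\biggr).$$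
   Context: $[A,B]=AB-BA$ denotes the matrix commutator, $\exp$ the matrix exponential and $\mathbf{1}$ the $d\times d$ identity matrix. For $s,t\in I$, $\Phi_A(t;s)$ is given by the Peano--Baker series $$\Phi_A(t;s)=\mathbf{1}+\sum_{n=1}^{\infty}\mathcal{I}_n(t;s),\qquad \mathcal{I}_n(t;s)=\int_{s}^{t}A(\tau_1)\int_{s}^{\tau_1}A(\tau_2)\cdots\int_{s}^{\tau_{n-1}}A(\tau_n)\,d\tau_n\cdots d\tau_2\,d\tau_1 ,$$ which converges for all $s,t\in I$; equivalently, $\mathcal{I}_0(t;s)=\mathbf{1}$ and $\mathcal{I}_{n+1}(t;s)=\int_s^t A(\tau)\,\mathcal{I}_n(\tau;s)\,d\tau$ for $n\geq 0$. Integrals of matrix- and vector-valued functions are taken entrywise and are oriented (so $\int_{s}^{t}=-\int_{t}^{s}$). At endpoints belonging to $I$, derivatives are one-sided. *)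

theory Defs
  imports "HOL-Analysis.Analysis"
begin

text \<open>
  The scalar field is a type variable of sort \<open>{real_normed_field, euclidean_space}\<close>. Both
  \<^typ>\<open>real\<close> and \<^typ>\<open>complex\<close> are of this sort, and by Frobenius' theorem on commutative real
  division algebras there are no other models up to isomorphism. The dimension \<open>d\<close> is
  \<open>CARD('d)\<close>.

  Two pitfalls: the library operations \<open>*\<close> and \<open>^\<close> on \<^typ>\<open>'k^'d^'d\<close> are componentwise, so
  products, powers and the exponential are built from the matrix product \<open>**\<close>; and
  \<open>LBINT x=a..b. f x\<close> is oriented, i.e. it changes sign when \<open>a\<close> and \<open>b\<close> are exchanged.
\<close>

definition commutator :: "'k::{real_normed_field, euclidean_space}^'d^'d \<Rightarrow> 'k^'d^'d \<Rightarrow> 'k^'d^'d"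
  where "commutator M N = M ** N - N ** M"

primrec mat_power :: "'k::{real_normed_field, euclidean_space}^'d^'d \<Rightarrow> nat \<Rightarrow> 'k^'d^'d"
  where
    "mat_power M 0 = mat 1"
  | "mat_power M (Suc n) = M ** mat_power M n"

definition mat_exp :: "'k::{real_normed_field, euclidean_space}^'d^'d \<Rightarrow> 'k^'d^'d"
  where "mat_exp M = (\<Sum>n. (1 / fact n) *\<^sub>R mat_power M n)"

text \<open>The arguments \<open>t s\<close> are in the order of \<open>\<I>\<^sub>n(t; s)\<close> and \<open>\<Phi>\<^sub>A(t; s)\<close>.\<close>

primrec peano_baker_term ::
    "(real \<Rightarrow> 'k::{real_normed_field, euclidean_space}^'d^'d) \<Rightarrow> nat \<Rightarrow> real \<Rightarrow> real \<Rightarrow> 'k^'d^'d"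
  where
    "peano_baker_term A 0 t s = mat 1"
  | "peano_baker_term A (Suc n) t s = (LBINT \<tau>=s..t. A \<tau> ** peano_baker_term A n \<tau> s)"

definition peano_baker ::
    "(real \<Rightarrow> 'k::{real_normed_field, euclidean_space}^'d^'d) \<Rightarrow> real \<Rightarrow> real \<Rightarrow> 'k^'d^'d"
  where "peano_baker A t s = mat 1 + (\<Sum>n. peano_baker_term A (Suc n) t s)"

text \<open>
  Solutions are total functions of which only the values on \<open>I\<close> matter; the derivative within
  \<open>I\<close> is the one-sided one at an endpoint of \<open>I\<close> and the ordinary one in the interior.
\<close>

definition cauchy_solution ::
    "real set \<Rightarrow> (real \<Rightarrow> 'k::{real_normed_field, euclidean_space}^'d^'d) \<Rightarrow> (real \<Rightarrow> 'k^'d) \<Rightarrow>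
     real \<Rightarrow> 'k^'d \<Rightarrow> (real \<Rightarrow> 'k^'d) \<Rightarrow> bool"
  where "cauchy_solution I A b t\<^sub>0 x\<^sub>0 x \<longleftrightarrow>
    (\<forall>t\<in>I. (x has_vector_derivative (A t *v x t + b t)) (at t within I)) \<and> x t\<^sub>0 = x\<^sub>0"

end

theory Submission
  imports Defs
begin

text \<open>
  Write \<open>X t\<close> for \<open>\<Phi>\<^sub>A(t; t\<^sub>0)\<close> and \<open>Z t\<close> for \<open>\<Phi>\<^sub>A(t\<^sub>0; t)\<close>. The theorem is variation of constants,
  and everything it needs is contained in three facts: \<open>X' = A X\<close>, \<open>Z' = - Z A\<close> and \<open>Z X = 1\<close>.
  Given these, \<open>y\<close> solves the inhomogeneous equation if and only if \<open>Z y\<close> has the derivative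
  \<open>Z b\<close>, which determines \<open>Z y\<close> up to its initial value; multiplying by \<open>X = Z\<^sup>-\<^sup>1\<close>
  yields the formula and its uniqueness together.

  The equation for \<open>X\<close> comes from differentiating the Peano--Baker series term by term. On a compact
  interval the \<open>n\<close>-th term is at most a constant times \<open>(M \<bar>t - s\<bar>)\<^sup>n / n!\<close>
  (\<open>norm_peano_baker_term_le\<close>), so the series and its derivative converge uniformly
  (\<open>peano_baker_on_compact\<close>). An arbitrary interval is reduced to compact ones, since
  differentiability at a point is local (\<open>at_within_interval_eq_Icc\<close>).

  The equation for \<open>Z\<close> concerns the dependence of the series on its lower limit, where its terms are
  awkward to differentiate. This is avoided by solving the adjoint equation independently: the
  transpose of the Peano--Baker series of \<open>- A\<^sup>T\<close> is a \<open>W\<close> with \<open>W' = - W A\<close> and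
  \<open>W t\<^sub>0 = 1\<close>. By the product rule \<open>W t \<Phi>\<^sub>A(t; r)\<close> does not depend on \<open>t\<close>, for every \<open>r\<close>.
  Comparing \<open>t = t\<^sub>0\<close> with \<open>t = r\<close> gives \<open>\<Phi>\<^sub>A(t\<^sub>0; r) = W r\<close>, so \<open>Z = W\<close>; taking \<open>r = t\<^sub>0\<close> gives
  \<open>Z X = 1\<close>.

  If the values of \<open>A\<close> commute, then \<open>A t\<close> commutes with \<open>B t = \<integral>\<^sub>s\<^sup>t A\<close>. Hence \<open>B\<^sup>n / n!\<close> obeys the
  recursion of the Peano--Baker terms, and the two series agree term by term
  (\<open>peano_baker_eq_mat_exp\<close>). The base point \<open>s\<close> is arbitrary there, so the same statement
  rewrites both \<open>X\<close> and \<open>Z\<close>.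
\<close>

section \<open>Matrix products as bounded bilinear maps\<close>

lemma bounded_bilinear_matrix_matrix_mult:
  "bounded_bilinear ((**) :: 'k::{real_normed_field, euclidean_space}^'m^'n \<Rightarrow> 'k^'p^'m \<Rightarrow> 'k^'p^'n)"
  unfolding bilinear_conv_bounded_bilinear[symmetric] bilinear_def linear_iff
  by (simp add: vec_eq_iff matrix_matrix_mult_def sum.distrib distrib_left distrib_right
      scaleR_sum_right)

lemma bounded_bilinear_matrix_vector_mult:
  "bounded_bilinear ((*v) :: 'k::{real_normed_field, euclidean_space}^'m^'n \<Rightarrow> 'k^'m \<Rightarrow> 'k^'n)"
  unfolding bilinear_conv_bounded_bilinear[symmetric] bilinear_def linear_iff
  by (simp add: vec_eq_iff matrix_vector_mult_def sum.distrib distrib_left distrib_right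
      scaleR_sum_right)

lemma bounded_linear_transpose:
  "bounded_linear (transpose :: 'k::{real_normed_field, euclidean_space}^'m^'n \<Rightarrow> 'k^'n^'m)"
  unfolding linear_conv_bounded_linear[symmetric] linear_iff
  by (simp add: vec_eq_iff transpose_def)

section \<open>Calculus on an arbitrary interval\<close>

text \<open>The endpoint \<open>a\<close> is taken strictly below \<open>t\<close> unless \<open>t\<close> is the least element of \<open>I\<close>,
  and likewise for \<open>b\<close>; then \<open>I\<close> and \<open>{a..b}\<close> coincide near \<open>t\<close>. This transports results on
  compact intervals, including one-sided derivatives at endpoints, to intervals that may be open,
  unbounded or a single point.\<close>

lemma at_within_interval_eq_Icc:
  fixes I :: "real set"
  assumes I: "is_interval I" "s \<in> I" "t \<in> I"
  obtains a b where "a \<le> s" "s \<le> b" "a \<le> t" "t \<le> b" "{a..b} \<subseteq> I"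
    "at t within I = at t within {a..b}"
proof -
  obtain a where a: "a \<in> I" "a \<le> s" "a \<le> t" "a < t \<or> (\<forall>u\<in>I. t \<le> u)"
  proof (cases "\<forall>u\<in>I. t \<le> u")
    case True
    then show thesis using I that[of t] by auto
  next
    case False
    then obtain u where "u \<in> I" "u < t" by force
    then show thesis using I that[of "min u s"] by (auto simp: min_def)
  qed
  obtain b where b: "b \<in> I" "s \<le> b" "t \<le> b" "t < b \<or> (\<forall>u\<in>I. u \<le> t)"
  proof (cases "\<forall>u\<in>I. u \<le> t")
    case True
    then show thesis using I that[of t] by auto
  next
    case False
    then obtain u where "u \<in> I" "t < u" by force
    then show thesis using I that[of "max u s"] by (auto simp: max_def)
  qed
  have sub: "{a..b} \<subseteq> I"
    using I(1) a(1) b(1) unfolding is_interval_1 by (meson atLeastAtMost_iff subsetI)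
  (* A neighbourhood of t that is cut off at a and b only where these differ from t. *)
  define U where "U = {(if a < t then a else t - 1)<..<(if t < b then b else t + 1)}"
  have "at t within I = at t within {a..b}"
  proof (rule at_within_nhd)
    show "t \<in> U" "open U" by (auto simp: U_def)
    show "I \<inter> U - {t} = {a..b} \<inter> U - {t}"
      using a b sub by (force simp: U_def split: if_splits)
  qed
  with a b sub show thesis using that by blast
qed

lemma interval_integral_has_vector_derivative:
  fixes f :: "real \<Rightarrow> 'a::euclidean_space"
  assumes "is_interval I" "s \<in> I" "t \<in> I" "continuous_on I f"
  shows "((\<lambda>u. LBINT y=s..u. f y) has_vector_derivative f t) (at t within I)"
proof -
  obtain a b where ab: "a \<le> s" "s \<le> b" "a \<le> t" "t \<le> b" "{a..b} \<subseteq> I"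
    "at t within I = at t within {a..b}"
    using at_within_interval_eq_Icc[OF assms(1-3)] .
  with assms(4) show ?thesis
    by (auto intro!: interval_integral_FTC2 intro: continuous_on_subset)
qed

lemma interval_integral_cong_on:
  fixes f g :: "real \<Rightarrow> 'a::{banach, second_countable_topology}"
  assumes "is_interval I" "s \<in> I" "t \<in> I" "\<And>u. u \<in> I \<Longrightarrow> f u = g u"
  shows "(LBINT u=s..t. f u) = (LBINT u=s..t. g u)"
proof (rule interval_integral_cong)
  fix u assume "u \<in> einterval (min (ereal s) (ereal t)) (max (ereal s) (ereal t))"
  then have "min s t < u" "u < max s t"
    by (auto simp: einterval_def min_def max_def split: if_splits)
  then have "u \<in> I"
    using assms(1-3) unfolding is_interval_1 by (smt (verit))
  then show "f u = g u" by (rule assms(4))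
qed

lemma eq_if_has_same_vector_derivative:
  fixes f g :: "real \<Rightarrow> 'a::real_normed_vector"
  assumes "is_interval I" "s \<in> I" "t \<in> I" "f s = g s"
    and f: "\<And>u. u \<in> I \<Longrightarrow> (f has_vector_derivative D u) (at u within I)"
    and g: "\<And>u. u \<in> I \<Longrightarrow> (g has_vector_derivative D u) (at u within I)"
  shows "f t = g t"
proof -
  have "((\<lambda>u. f u - g u) has_vector_derivative 0) (at u within I)" if "u \<in> I" for u
    using has_vector_derivative_diff[OF f g, OF that that] by simp
  then obtain c where "\<And>u. u \<in> I \<Longrightarrow> f u - g u = c"
    using has_vector_derivative_zero_constant[of I "\<lambda>u. f u - g u"] assms(1)
    by (metis is_interval_convex)
  with assms(2-4) show ?thesis by (metis eq_iff_diff_eq_0)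
qed

text \<open>This is one step of the iteration behind the factorial bound. Pulling \<open>f\<close> back along the
  affine path from \<open>s\<close> to \<open>t\<close> makes the argument indifferent to the order of \<open>s\<close> and \<open>t\<close>, so
  that no oriented integral of \<open>\<bar>u - s\<bar>\<^sup>n\<close> has to be estimated.\<close>

lemma norm_le_power_if_derivative_le_power:
  fixes f :: "real \<Rightarrow> 'a::real_normed_vector"
  assumes J: "is_interval J" "s \<in> J" "t \<in> J" and "f s = 0"
    and f: "\<And>u. u \<in> J \<Longrightarrow> (f has_vector_derivative f' u) (at u within J)"
    and le: "\<And>u. u \<in> J \<Longrightarrow> norm (f' u) \<le> C * \<bar>u - s\<bar> ^ n"
  shows "norm (f t) \<le> C * \<bar>t - s\<bar> ^ Suc n / Suc n"
proof -
  define p where "p u = s + u * (t - s)" for u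
  have pJ: "p u \<in> J" if "u \<in> {0..1}" for u
  proof -
    have "(1 - u) *\<^sub>R s + u *\<^sub>R t \<in> J"
      using J that by (intro convexD is_interval_convex) auto
    then show ?thesis by (simp add: p_def algebra_simps)
  qed
  have p': "(p has_vector_derivative (t - s)) (at u within {0..1})" for u
    unfolding p_def by (auto intro!: derivative_eq_intros)
  have g': "((f \<circ> p) has_vector_derivative (t - s) *\<^sub>R f' (p u)) (at u within {0..1})"
    if "u \<in> {0..1}" for u
    by (intro vector_diff_chain_within p' has_vector_derivative_within_subset[OF f])
      (use pJ that in blast)+
  define \<phi> where "\<phi> u = C * \<bar>t - s\<bar> ^ Suc n / Suc n * u ^ Suc n" for u :: real
  have \<phi>': "(\<phi> has_vector_derivative C * \<bar>t - s\<bar> ^ Suc n * u ^ n) (at u)" for u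
  proof -
    have "(\<phi> has_vector_derivative C * \<bar>t - s\<bar> ^ Suc n / Suc n * (Suc n * u ^ n)) (at u)"
      unfolding \<phi>_def has_real_derivative_iff_has_vector_derivative[symmetric]
      by (rule derivative_eq_intros refl | simp)+
    then show ?thesis by (simp add: mult.assoc del: of_nat_Suc power_Suc)
  qed
  have "norm ((f \<circ> p) 1 - (f \<circ> p) 0) \<le> \<phi> 1 - \<phi> 0"
  proof (rule differentiable_bound_general)
    show "continuous_on {0..1} (f \<circ> p)"
      using g' by (rule continuous_on_vector_derivative)
    show "continuous_on {0..1} \<phi>"
      using has_vector_derivative_at_within[OF \<phi>'] by (rule continuous_on_vector_derivative)
    fix u :: real assume u: "0 < u" "u < 1"
    show "((f \<circ> p) has_vector_derivative (t - s) *\<^sub>R f' (p u)) (at u)"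
      using g'[of u] u by (simp add: at_within_Icc_at)
    have "norm (f' (p u)) \<le> C * (\<bar>t - s\<bar> * u) ^ n"
      using le[OF pJ, of u] u by (simp add: p_def abs_mult mult.commute)
    then have "\<bar>t - s\<bar> * norm (f' (p u)) \<le> \<bar>t - s\<bar> * (C * (\<bar>t - s\<bar> * u) ^ n)"
      by (rule mult_left_mono) simp
    then show "norm ((t - s) *\<^sub>R f' (p u)) \<le> C * \<bar>t - s\<bar> ^ Suc n * u ^ n"
      by (simp add: power_mult_distrib mult_ac)
  qed (use \<phi>' in auto)
  then show ?thesis using \<open>f s = 0\<close> by (simp add: p_def \<phi>_def)
qed

section \<open>The Peano--Baker series\<close>

context
  fixes I :: "real set" and A :: "real \<Rightarrow> 'k::{real_normed_field, euclidean_space}^'d^'d"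
  assumes I: "is_interval I" and A: "continuous_on I A"
begin

lemma peano_baker_term_continuous_on:
  assumes "s \<in> I"
  shows "continuous_on I (\<lambda>t. peano_baker_term A n t s)"
proof (induction n)
  case (Suc n)
  have "continuous_on I (\<lambda>t. A t ** peano_baker_term A n t s)"
    by (rule bounded_bilinear.continuous_on[OF bounded_bilinear_matrix_matrix_mult A Suc])
  note deriv = interval_integral_has_vector_derivative[OF I assms _ this]
  show ?case
    unfolding peano_baker_term.simps
    by (rule continuous_on_vector_derivative[OF deriv])
qed simp

lemma peano_baker_term_has_vector_derivative:
  assumes "s \<in> I" "t \<in> I"
  shows "((\<lambda>t. peano_baker_term A (Suc n) t s) has_vector_derivative
    A t ** peano_baker_term A n t s) (at t within I)"
  unfolding peano_baker_term.simps
  by (intro interval_integral_has_vector_derivative assms I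
      bounded_bilinear.continuous_on[OF bounded_bilinear_matrix_matrix_mult A]
      peano_baker_term_continuous_on)

text \<open>The factorial arises by integrating \<open>M * (M * \<bar>u - s\<bar>) ^ n / fact n\<close> at each step. Here \<open>M\<close> bounds the
  operators \<open>X \<mapsto> A u ** X\<close>, so it absorbs the constant of the bounded bilinear product, and the
  first factor is there because the identity matrix has norm \<open>\<surd>d\<close>.\<close>

lemma norm_peano_baker_term_le:
  assumes "s \<in> I" "t \<in> I" "0 \<le> M" and M: "\<And>u (X :: 'k^'d^'d). u \<in> I \<Longrightarrow> norm (A u ** X) \<le> M * norm X"
  shows "norm (peano_baker_term A n t s)
    \<le> norm (mat 1 :: 'k^'d^'d) * (M ^ n * \<bar>t - s\<bar> ^ n / fact n)"
  using \<open>t \<in> I\<close>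
proof (induction n arbitrary: t)
  case (Suc n)
  define C where "C = norm (mat 1 :: 'k^'d^'d) * M ^ Suc n / fact n"
  have "norm (peano_baker_term A (Suc n) t s) \<le> C * \<bar>t - s\<bar> ^ Suc n / Suc n"
  proof (rule norm_le_power_if_derivative_le_power[OF I \<open>s \<in> I\<close> Suc.prems])
    show "((\<lambda>t. peano_baker_term A (Suc n) t s) has_vector_derivative
        A u ** peano_baker_term A n u s) (at u within I)" if "u \<in> I" for u
      using peano_baker_term_has_vector_derivative assms(1) that .
    show "norm (A u ** peano_baker_term A n u s) \<le> C * \<bar>u - s\<bar> ^ n" if "u \<in> I" for u
      using M[OF that, of "peano_baker_term A n u s"] mult_left_mono[OF Suc.IH[OF that] \<open>0 \<le> M\<close>]
      by (simp add: C_def mult_ac)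
  qed simp
  then show ?case by (simp add: C_def field_simps)
qed simp

end

text \<open>By compactness \<open>A\<close> is bounded, and the factorial bound becomes a convergent majorant that
  is uniform in \<open>t\<close>. As the derivative of term \<open>n + 1\<close> is \<open>A\<close> times term \<open>n\<close>, differentiating the
  sum of the terms from index one on gives \<open>A\<close> times the whole series.\<close>

lemma peano_baker_on_compact:
  fixes A :: "real \<Rightarrow> 'k::{real_normed_field, euclidean_space}^'d^'d"
  assumes A: "continuous_on {a..b} A" and s: "s \<in> {a..b}"
  shows "\<And>t. t \<in> {a..b} \<Longrightarrow> summable (\<lambda>n. peano_baker_term A n t s)"
    and "\<And>t. t \<in> {a..b} \<Longrightarrow>
      ((\<lambda>t. peano_baker A t s) has_vector_derivative A t ** peano_baker A t s) (at t within {a..b})"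
proof -
  let ?T = "\<lambda>n t. peano_baker_term A n t s"
  have I: "is_interval {a..b}" by (rule is_interval_cc)
  obtain B where B: "B > 0" "\<And>t. t \<in> {a..b} \<Longrightarrow> norm (A t) \<le> B"
    using compact_imp_bounded[OF compact_continuous_image[OF A compact_Icc]]
    unfolding bounded_pos by auto
  obtain K where K: "K > 0" "\<And>(X :: 'k^'d^'d) (Y :: 'k^'d^'d). norm (X ** Y) \<le> norm X * norm Y * K"
    using bounded_bilinear.pos_bounded[OF bounded_bilinear_matrix_matrix_mult] by blast
  define M where "M = K * B"
  have "0 \<le> M" using B K by (simp add: M_def)
  have M: "norm (A t ** X) \<le> M * norm X" if "t \<in> {a..b}" for t and X :: "'k^'d^'d"
  proof -
    have "norm (A t ** X) \<le> norm (A t) * norm X * K" by (rule K(2))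
    also have "\<dots> \<le> B * norm X * K"
      using B(2)[OF that] K(1) by (intro mult_right_mono) auto
    finally show ?thesis by (simp add: M_def mult_ac)
  qed
  define c where "c n = norm (mat 1 :: 'k^'d^'d) * ((M * (b - a)) ^ n / fact n)" for n
  have c: "summable c"
    unfolding c_def using summable_exp[of "M * (b - a)"]
    by (intro summable_mult) (simp add: field_simps)
  have T_le: "norm (?T n t) \<le> c n" if "t \<in> {a..b}" for n t
  proof -
    have "\<bar>t - s\<bar> ^ n \<le> (b - a) ^ n"
      using s that by (intro power_mono) auto
    then have "norm (mat 1 :: 'k^'d^'d) * (M ^ n * \<bar>t - s\<bar> ^ n / fact n)
        \<le> norm (mat 1 :: 'k^'d^'d) * (M ^ n * (b - a) ^ n / fact n)"
      using \<open>0 \<le> M\<close> by (intro mult_left_mono divide_right_mono) auto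
    with norm_peano_baker_term_le[OF I A s that \<open>0 \<le> M\<close> M, of n] show ?thesis
      by (simp add: c_def power_mult_distrib)
  qed
  show summable_T: "summable (\<lambda>n. ?T n t)" if "t \<in> {a..b}" for t
    using summable_comparison_test'[OF c, of 0 "\<lambda>n. ?T n t"] T_le[OF that] by blast
  have series: "peano_baker A t s = (\<Sum>n. ?T n t)" if "t \<in> {a..b}" for t
    using suminf_split_head[OF summable_T[OF that]] by (simp add: peano_baker_def)
  have A_series: "(\<Sum>n. A t ** ?T n t) = A t ** peano_baker A t s" if "t \<in> {a..b}" for t
    using bounded_linear.suminf[OF bounded_bilinear.bounded_linear_right
        [OF bounded_bilinear_matrix_matrix_mult] summable_T[OF that], of "A t"]
    by (simp add: series[OF that])
  have "uniform_limit {a..b} (\<lambda>n t. \<Sum>i<n. A t ** ?T i t) (\<lambda>t. \<Sum>i. A t ** ?T i t) sequentially"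
  proof (rule Weierstrass_m_test)
    show "norm (A t ** ?T n t) \<le> M * c n" if "t \<in> {a..b}" for n t
      using M[OF that] mult_left_mono[OF T_le[OF that] \<open>0 \<le> M\<close>] by (rule order_trans)
    show "summable (\<lambda>n. M * c n)" using c by (rule summable_mult)
  qed
  then have lim: "uniform_limit {a..b} (\<lambda>n t. \<Sum>i<n. A t ** ?T i t)
      (\<lambda>t. A t ** peano_baker A t s) sequentially"
    by (rule uniform_limit_cong'[THEN iffD1, rotated -1]) (simp_all add: A_series)
  have "\<exists>g. \<forall>t\<in>{a..b}. (\<lambda>n. ?T (Suc n) t) sums g t \<and>
      (g has_derivative (\<lambda>h. h *\<^sub>R (A t ** peano_baker A t s))) (at t within {a..b})"
  proof (rule has_derivative_series)
    show "((\<lambda>t. ?T (Suc n) t) has_derivative (\<lambda>h. h *\<^sub>R (A t ** ?T n t))) (at t within {a..b})"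
      if "t \<in> {a..b}" for n t
      using peano_baker_term_has_vector_derivative[OF I A s that, of n]
      by (simp add: has_vector_derivative_def)
    show "\<forall>\<^sub>F n in sequentially. \<forall>t\<in>{a..b}. \<forall>h.
        norm ((\<Sum>i<n. h *\<^sub>R (A t ** ?T i t)) - h *\<^sub>R (A t ** peano_baker A t s)) \<le> e * norm h"
      if "e > 0" for e
      using uniform_limitD[OF lim that]
    proof eventually_elim
      case (elim n)
      have "norm ((\<Sum>i<n. h *\<^sub>R (A t ** ?T i t)) - h *\<^sub>R (A t ** peano_baker A t s))
          \<le> e * norm h" if "t \<in> {a..b}" for t h
      proof -
        have "norm ((\<Sum>i<n. h *\<^sub>R (A t ** ?T i t)) - h *\<^sub>R (A t ** peano_baker A t s))
            = norm h * dist (\<Sum>i<n. A t ** ?T i t) (A t ** peano_baker A t s)"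
          by (simp only: scaleR_sum_right[symmetric] scaleR_diff_right[symmetric] norm_scaleR
              dist_norm real_norm_def)
        also have "\<dots> \<le> norm h * e"
          using elim that by (intro mult_left_mono) (auto intro: less_imp_le)
        finally show ?thesis by (simp add: mult.commute)
      qed
      then show ?case by blast
    qed
    show "(\<lambda>n. ?T (Suc n) s) sums (\<Sum>n. ?T (Suc n) s)"
      using summable_T[OF s] summable_Suc_iff summable_sums by blast
  qed (use s in auto)
  then obtain g where g: "\<And>t. t \<in> {a..b} \<Longrightarrow> (\<lambda>n. ?T (Suc n) t) sums g t"
    "\<And>t. t \<in> {a..b} \<Longrightarrow>
      (g has_vector_derivative A t ** peano_baker A t s) (at t within {a..b})"
    unfolding has_vector_derivative_def by blast
  show "((\<lambda>t. peano_baker A t s) has_vector_derivative A t ** peano_baker A t s)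
      (at t within {a..b})" if t: "t \<in> {a..b}" for t
  proof (rule has_vector_derivative_transform[OF t])
    show "peano_baker A u s = mat 1 + g u" if "u \<in> {a..b}" for u
      using sums_unique[OF g(1)[OF that]] by (simp add: peano_baker_def)
    show "((\<lambda>u. mat 1 + g u) has_vector_derivative A t ** peano_baker A t s) (at t within {a..b})"
      using has_vector_derivative_add[OF has_vector_derivative_const g(2)[OF t]] by simp
  qed
qed

lemma peano_baker_same [simp]: "peano_baker A s s = mat 1"
  by (simp add: peano_baker_def)

context
  fixes I :: "real set" and A :: "real \<Rightarrow> 'k::{real_normed_field, euclidean_space}^'d^'d"
  assumes I: "is_interval I" and A: "continuous_on I A"
begin

lemma summable_peano_baker_term:
  assumes "s \<in> I" "t \<in> I"
  shows "summable (\<lambda>n. peano_baker_term A n t s)"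
proof -
  obtain a b where "a \<le> s" "s \<le> b" "a \<le> t" "t \<le> b" "{a..b} \<subseteq> I"
    using at_within_interval_eq_Icc[OF I assms] .
  then show ?thesis
    using peano_baker_on_compact(1)[of a b A s t] continuous_on_subset[OF A] by auto
qed

lemma peano_baker_has_vector_derivative:
  assumes "s \<in> I" "t \<in> I"
  shows "((\<lambda>t. peano_baker A t s) has_vector_derivative A t ** peano_baker A t s) (at t within I)"
proof -
  obtain a b where "a \<le> s" "s \<le> b" "a \<le> t" "t \<le> b" "{a..b} \<subseteq> I"
    "at t within I = at t within {a..b}"
    using at_within_interval_eq_Icc[OF I assms] .
  then show ?thesis
    using peano_baker_on_compact(2)[of a b A s t] continuous_on_subset[OF A] by auto
qed

end

context
  fixes I :: "real set" and A :: "real \<Rightarrow> 'k::{real_normed_field, euclidean_space}^'d^'d"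
  assumes I: "is_interval I" and A: "continuous_on I A"
begin

text \<open>Transposition turns \<open>Z' = - Z A\<close> into \<open>(Z\<^sup>T)' = - A\<^sup>T Z\<^sup>T\<close>, an equation with the unknown on the
  right, which the Peano--Baker series solves.\<close>

lemma adjoint_solution_exists:
  assumes "s \<in> I"
  shows "\<exists>Z :: real \<Rightarrow> 'k^'d^'d. Z s = mat 1 \<and>
    (\<forall>t\<in>I. (Z has_vector_derivative - (Z t ** A t)) (at t within I))"
proof -
  define B where "B t = - transpose (A t)" for t
  have B: "continuous_on I B"
    unfolding B_def
    by (intro continuous_on_minus bounded_linear.continuous_on[OF bounded_linear_transpose] A)
  have "((\<lambda>t. transpose (peano_baker B t s)) has_vector_derivative
      - (transpose (peano_baker B t s) ** A t)) (at t within I)" if t: "t \<in> I" for t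
  proof -
    have "((\<lambda>t. peano_baker B t s) has_vector_derivative B t ** peano_baker B t s) (at t within I)"
      by (rule peano_baker_has_vector_derivative[OF I B assms t])
    then have "((\<lambda>t. transpose (peano_baker B t s)) has_vector_derivative
        transpose (B t ** peano_baker B t s)) (at t within I)"
      by (rule bounded_linear.has_vector_derivative[OF bounded_linear_transpose])
    moreover have "transpose (B t ** peano_baker B t s) = - (transpose (peano_baker B t s) ** A t)"
      by (simp add: matrix_transpose_mul B_def bounded_linear.linear[OF bounded_linear_transpose]
          linear_neg bounded_bilinear.minus_right[OF bounded_bilinear_matrix_matrix_mult])
    ultimately show ?thesis by simp
  qed
  then show ?thesis
    by (intro exI[of _ "\<lambda>t. transpose (peano_baker B t s)"]) simp
qed

text \<open>Both facts follow from the invariance of \<open>Z t ** \<Phi>\<^sub>A(t; r)\<close> in \<open>t\<close>, where \<open>Z\<close> solves the adjoint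
  equation with \<open>Z s = 1\<close>.\<close>

lemma
  assumes s: "s \<in> I" and t: "t \<in> I"
  shows peano_baker_swap_has_vector_derivative: "((\<lambda>t. peano_baker A s t) has_vector_derivative
      - (peano_baker A s t ** A t)) (at t within I)"
    and peano_baker_inverse: "peano_baker A s t ** peano_baker A t s = mat 1"
proof -
  obtain Z :: "real \<Rightarrow> 'k^'d^'d" where Zs: "Z s = mat 1"
    and Z: "\<And>t. t \<in> I \<Longrightarrow> (Z has_vector_derivative - (Z t ** A t)) (at t within I)"
    using adjoint_solution_exists[OF s] by blast
  have ZX: "Z t ** peano_baker A t r = Z u ** peano_baker A u r"
    if r: "r \<in> I" and t: "t \<in> I" and u: "u \<in> I" for r t u
  proof (rule eq_if_has_same_vector_derivative[OF I u t, where D = "\<lambda>_. 0"])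
    fix v assume v: "v \<in> I"
    have "((\<lambda>v. Z v ** peano_baker A v r) has_vector_derivative
        Z v ** (A v ** peano_baker A v r) + - (Z v ** A v) ** peano_baker A v r) (at v within I)"
      by (intro bounded_bilinear.has_vector_derivative[OF bounded_bilinear_matrix_matrix_mult]
          Z peano_baker_has_vector_derivative[OF I A] r v)
    then show "((\<lambda>v. Z v ** peano_baker A v r) has_vector_derivative 0) (at v within I)"
      by (simp add: matrix_mul_assoc
          bounded_bilinear.minus_left[OF bounded_bilinear_matrix_matrix_mult])
  qed auto
  have swap: "peano_baker A s u = Z u" if "u \<in> I" for u
    using ZX[OF that s that] by (simp add: Zs)
  show "((\<lambda>t. peano_baker A s t) has_vector_derivative
      - (peano_baker A s t ** A t)) (at t within I)"
    using has_vector_derivative_transform[OF t swap Z[OF t]] by (simp add: swap t)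
  show "peano_baker A s t ** peano_baker A t s = mat 1"
    using ZX[OF s t s] by (simp add: swap t Zs)
qed

end

section \<open>Commuting coefficient matrices\<close>

text \<open>The power rule holds because \<open>B'\<close> can be moved to the front of every summand of the
  product rule, which is possible as soon as it commutes with the value of \<open>B\<close> at this
  one point.\<close>

lemma mat_power_has_vector_derivative:
  fixes B :: "real \<Rightarrow> 'k::{real_normed_field, euclidean_space}^'d^'d"
  assumes B: "(B has_vector_derivative B') (at t within I)" and comm: "B' ** B t = B t ** B'"
  shows "((\<lambda>t. mat_power (B t) (Suc n)) has_vector_derivative
    real (Suc n) *\<^sub>R (B' ** mat_power (B t) n)) (at t within I)"
proof (induction n)
  case 0
  then show ?case using B by simp
next
  case (Suc n)
  have "((\<lambda>t. B t ** mat_power (B t) (Suc n)) has_vector_derivative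
      B t ** (real (Suc n) *\<^sub>R (B' ** mat_power (B t) n)) + B' ** mat_power (B t) (Suc n))
      (at t within I)"
    by (intro bounded_bilinear.has_vector_derivative[OF bounded_bilinear_matrix_matrix_mult] B Suc)
  moreover have "B t ** (real (Suc n) *\<^sub>R (B' ** mat_power (B t) n))
      + B' ** mat_power (B t) (Suc n) = real (Suc (Suc n)) *\<^sub>R (B' ** mat_power (B t) (Suc n))"
  proof -
    have "B t ** (B' ** mat_power (B t) n) = B' ** mat_power (B t) (Suc n)"
      by (simp add: matrix_mul_assoc comm)
    then show ?thesis
      by (simp add: bounded_bilinear.scaleR_right[OF bounded_bilinear_matrix_matrix_mult]
          of_nat_Suc[of "Suc n"] scaleR_add_left del: of_nat_Suc mat_power.simps)
  qed
  ultimately show ?case by simp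
qed

context
  fixes I :: "real set" and A :: "real \<Rightarrow> 'k::{real_normed_field, euclidean_space}^'d^'d"
  assumes I: "is_interval I" and A: "continuous_on I A"
begin

text \<open>Both sides are antiderivatives of \<open>N ** A u\<close> that vanish at \<open>s\<close>.\<close>

lemma integral_commute:
  assumes "s \<in> I" "t \<in> I" and N: "\<And>u. u \<in> I \<Longrightarrow> N ** A u = A u ** N"
  shows "N ** (LBINT u=s..t. A u) = (LBINT u=s..t. A u) ** N"
proof (rule eq_if_has_same_vector_derivative[OF I assms(1,2), where D = "\<lambda>u. N ** A u"])
  fix u assume u: "u \<in> I"
  note B = interval_integral_has_vector_derivative[OF I \<open>s \<in> I\<close> u A]
  show "((\<lambda>u. N ** (LBINT v=s..u. A v)) has_vector_derivative N ** A u) (at u within I)"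
    by (rule bounded_linear.has_vector_derivative[OF bounded_bilinear.bounded_linear_right
          [OF bounded_bilinear_matrix_matrix_mult] B])
  show "((\<lambda>u. (LBINT v=s..u. A v) ** N) has_vector_derivative N ** A u) (at u within I)"
    unfolding N[OF u]
    by (rule bounded_linear.has_vector_derivative[OF bounded_bilinear.bounded_linear_left
          [OF bounded_bilinear_matrix_matrix_mult] B])
qed simp

text \<open>By induction, term \<open>n\<close> of the Peano--Baker series and term \<open>n\<close> of the exponential series
  have the same derivative and the same value at \<open>s\<close>.\<close>

lemma peano_baker_eq_mat_exp:
  assumes comm: "\<And>t s. t \<in> I \<Longrightarrow> s \<in> I \<Longrightarrow> A t ** A s = A s ** A t"
    and s: "s \<in> I" and t: "t \<in> I"
  shows "peano_baker A t s = mat_exp (LBINT u=s..t. A u)"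
proof -
  define B where "B t = (LBINT u=s..t. A u)" for t :: real
  have B: "(B has_vector_derivative A u) (at u within I)" if "u \<in> I" for u
    unfolding B_def by (rule interval_integral_has_vector_derivative[OF I s that A])
  have AB: "A u ** B u = B u ** A u" if "u \<in> I" for u
    unfolding B_def by (rule integral_commute[OF s that comm[OF that]])
  have terms: "peano_baker_term A n t s = (1 / fact n) *\<^sub>R mat_power (B t) n" if "t \<in> I" for n t
    using that
  proof (induction n arbitrary: t)
    case (Suc n)
    show ?case
    proof (rule eq_if_has_same_vector_derivative[OF I s Suc.prems])
      fix u assume u: "u \<in> I"
      show "((\<lambda>t. peano_baker_term A (Suc n) t s) has_vector_derivative
          A u ** peano_baker_term A n u s) (at u within I)"
        by (rule peano_baker_term_has_vector_derivative[OF I A s u])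
      have "((\<lambda>u. (1 / fact (Suc n)) *\<^sub>R mat_power (B u) (Suc n)) has_vector_derivative
          (1 / fact (Suc n)) *\<^sub>R (real (Suc n) *\<^sub>R (A u ** mat_power (B u) n))) (at u within I)"
        by (intro bounded_linear.has_vector_derivative[OF bounded_linear_scaleR_right]
            mat_power_has_vector_derivative B AB u)
      then show "((\<lambda>u. (1 / fact (Suc n)) *\<^sub>R mat_power (B u) (Suc n)) has_vector_derivative
          A u ** peano_baker_term A n u s) (at u within I)"
        by (simp add: Suc.IH[OF u] field_simps
            bounded_bilinear.scaleR_right[OF bounded_bilinear_matrix_matrix_mult] del: of_nat_Suc)
    qed (simp add: B_def)
  qed simp
  have "peano_baker A t s = (\<Sum>n. peano_baker_term A n t s)"
    using suminf_split_head[OF summable_peano_baker_term[OF I A s t]] by (simp add: peano_baker_def)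
  also have "\<dots> = mat_exp (B t)"
    by (simp add: terms[OF t] mat_exp_def)
  finally show ?thesis by (simp add: B_def)
qed

end

section \<open>Variation of constants\<close>

theorem theorem2:
  fixes I :: "real set"
    and A :: "real \<Rightarrow> 'k::{real_normed_field, euclidean_space}^'d^'d"
    and b :: "real \<Rightarrow> 'k^'d"
    and t\<^sub>0 :: real
    and x\<^sub>0 :: "'k^'d"
  assumes "is_interval I"
    and "t\<^sub>0 \<in> I"
    and "continuous_on I A"
    and "continuous_on I b"
  shows "let x = (\<lambda>t. peano_baker A t t\<^sub>0 *v (x\<^sub>0 + (LBINT \<tau>=t\<^sub>0..t. peano_baker A t\<^sub>0 \<tau> *v b \<tau>)))
    in cauchy_solution I A b t\<^sub>0 x\<^sub>0 x \<and>
       (\<forall>y. cauchy_solution I A b t\<^sub>0 x\<^sub>0 y \<longrightarrow> (\<forall>t\<in>I. y t = x t)) \<and>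
       ((\<forall>t\<in>I. \<forall>s\<in>I. commutator (A t) (A s) = 0) \<longrightarrow>
         (\<forall>t\<in>I. x t = mat_exp (LBINT \<tau>=t\<^sub>0..t. A \<tau>) *v
           (x\<^sub>0 + (LBINT \<tau>=t\<^sub>0..t. mat_exp (- (LBINT \<sigma>=t\<^sub>0..\<tau>. A \<sigma>)) *v b \<tau>))))"
proof -
  note I = assms(1) and t0 = assms(2) and A = assms(3)
  let ?X = "\<lambda>t. peano_baker A t t\<^sub>0" and ?Z = "\<lambda>t. peano_baker A t\<^sub>0 t"
  (* The varied constant: solutions will turn out to be exactly ?X t *v w t. *)
  define w where "w t = x\<^sub>0 + (LBINT \<tau>=t\<^sub>0..t. ?Z \<tau> *v b \<tau>)" for t
  have Z: "(?Z has_vector_derivative - (?Z t ** A t)) (at t within I)" if "t \<in> I" for t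
    by (rule peano_baker_swap_has_vector_derivative[OF I A t0 that])
  have ZX: "?Z t ** ?X t = mat 1" if "t \<in> I" for t
    by (rule peano_baker_inverse[OF I A t0 that])
  then have XZ: "?X t ** ?Z t = mat 1" if "t \<in> I" for t
    using that matrix_left_right_inverse by blast
  have w0: "w t\<^sub>0 = x\<^sub>0" by (simp add: w_def)
  have w: "(w has_vector_derivative ?Z t *v b t) (at t within I)" if "t \<in> I" for t
  proof -
    have "continuous_on I (\<lambda>t. ?Z t *v b t)"
      using continuous_on_vector_derivative[OF Z] assms(4)
      by (rule bounded_bilinear.continuous_on[OF bounded_bilinear_matrix_vector_mult])
    from has_vector_derivative_add[OF has_vector_derivative_const
        interval_integral_has_vector_derivative[OF I t0 that this]]
    show ?thesis by (simp add: w_def[abs_def])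
  qed
  have "cauchy_solution I A b t\<^sub>0 x\<^sub>0 (\<lambda>t. ?X t *v w t)"
    unfolding cauchy_solution_def
  proof (intro conjI ballI)
    fix t assume t: "t \<in> I"
    have "((\<lambda>t. ?X t *v w t) has_vector_derivative
        ?X t *v (?Z t *v b t) + (A t ** ?X t) *v w t) (at t within I)"
      by (intro bounded_bilinear.has_vector_derivative[OF bounded_bilinear_matrix_vector_mult]
          peano_baker_has_vector_derivative[OF I A t0 t] w t)
    then show "((\<lambda>t. ?X t *v w t) has_vector_derivative A t *v (?X t *v w t) + b t) (at t within I)"
      by (simp add: matrix_vector_mul_assoc XZ[OF t] add.commute)
  qed (simp add: w0)
  moreover have "y t = ?X t *v w t" if y: "cauchy_solution I A b t\<^sub>0 x\<^sub>0 y" and t: "t \<in> I" for y t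
  proof -
    (* In ?Z *v y the terms containing A cancel, which leaves the derivative of w. *)
    have "?Z t *v y t = w t"
    proof (rule eq_if_has_same_vector_derivative[OF I t0 t _ _ w])
      fix u assume u: "u \<in> I"
      have "((\<lambda>u. ?Z u *v y u) has_vector_derivative
          ?Z u *v (A u *v y u + b u) + - (?Z u ** A u) *v y u) (at u within I)"
        using y u unfolding cauchy_solution_def
        by (intro bounded_bilinear.has_vector_derivative[OF bounded_bilinear_matrix_vector_mult] Z)
          auto
      then show "((\<lambda>u. ?Z u *v y u) has_vector_derivative ?Z u *v b u) (at u within I)"
        by (simp add: matrix_vector_right_distrib matrix_vector_mul_assoc
            bounded_bilinear.minus_left[OF bounded_bilinear_matrix_vector_mult])
    qed (use y in \<open>simp_all add: cauchy_solution_def w0\<close>)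
    then have "?X t *v (?Z t *v y t) = ?X t *v w t" by simp
    then show ?thesis by (simp add: matrix_vector_mul_assoc XZ[OF t])
  qed
  moreover have "?X t *v w t = mat_exp (LBINT \<tau>=t\<^sub>0..t. A \<tau>) *v
      (x\<^sub>0 + (LBINT \<tau>=t\<^sub>0..t. mat_exp (- (LBINT \<sigma>=t\<^sub>0..\<tau>. A \<sigma>)) *v b \<tau>))"
    if comm: "\<forall>t\<in>I. \<forall>s\<in>I. commutator (A t) (A s) = 0" and t: "t \<in> I" for t
  proof -
    have AA: "A u ** A v = A v ** A u" if "u \<in> I" "v \<in> I" for u v
      using comm that by (simp add: commutator_def)
    have exp: "peano_baker A u v = mat_exp (LBINT \<sigma>=v..u. A \<sigma>)" if "u \<in> I" "v \<in> I" for u v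
      by (rule peano_baker_eq_mat_exp[OF I A]) (use AA that in auto)
    (* Here the base point is u and not t0; reversing the integral produces the minus sign. *)
    have "?Z u = mat_exp (- (LBINT \<sigma>=t\<^sub>0..u. A \<sigma>))" if "u \<in> I" for u
      using exp[OF t0 that]
      by (simp only: interval_integral_endpoints_reverse[of "ereal u" "ereal t\<^sub>0"])
    then have "w t = x\<^sub>0 + (LBINT \<tau>=t\<^sub>0..t. mat_exp (- (LBINT \<sigma>=t\<^sub>0..\<tau>. A \<sigma>)) *v b \<tau>)"
      unfolding w_def by (intro arg_cong2[of _ _ _ _ "(+)"] interval_integral_cong_on[OF I t0 t]) auto
    then show ?thesis
      by (simp add: exp[OF t t0])
  qed
  ultimately show ?thesis
    unfolding Let_def w_def by blast
qed

end
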